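(* Let $p$ be a prime. If there exists $A\subseteq\mathbb{F}_p$ with $A-A\doteq\mathcal{R}_p$, then for every prime $q$ dividing $\frac{p-1}{4}$, the multiplicative order $\operatorname{ord}_p(q)$ of $q$ modulo $p$ is odd.
   Context: $\mathcal{R}_p$ is the set of nonzero quadratic residues modulo $p$. $A-A\doteq S$ means: every element of $S$ has exactly one representation as $a'-a''$ with $a',a''\in A$, and every difference $a'-a''$ with $a'\ne a''$ in $A$ lies in $S$. (Such $A$ forces $p\equiv 1\pmod 4$ and $p=2|A|(|A|-1)+1$.) *)

theory Defs
  imports "HOL-Number_Theory.Number_Theory"
begin

text \<open>F_p is modelled by the residues {0..<p} (as integers), arithmetic mod p.\<close>

definition quad_res_set :: "nat \<Rightarrow> int set" where
  "quad_res_set p = {x \<in> {1..<int p}. QuadRes (int p) x}"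

definition diff_exact :: "nat \<Rightarrow> int set \<Rightarrow> int set \<Rightarrow> bool" where
  "diff_exact p A S \<longleftrightarrow>
     (\<forall>s\<in>S. \<exists>!(a1, a2). a1 \<in> A \<and> a2 \<in> A \<and> (a1 - a2) mod int p = s) \<and>
     (\<forall>a1\<in>A. \<forall>a2\<in>A. a1 \<noteq> a2 \<longrightarrow> (a1 - a2) mod int p \<in> S)"

end

theory Submission
  imports Defs "HOL-Computational_Algebra.Polynomial"
begin

text \<open>
  Work in the group ring \<open>\<int>[x]/(q, x\<^sup>p - 1)\<close>. Put \<open>n = |A|\<close>, \<open>k = (p - 1)/4\<close>, and fix a
  nonresidue \<open>r\<close>. Since differences of \<open>A\<close> are residues, the sums \<open>a + r b\<close> with \<open>a, b \<in> A\<close> are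
  pairwise distinct modulo \<open>p\<close>; let \<open>C\<close> be the set of these \<open>n\<^sup>2\<close> sums, \<open>B = \<Sum>c\<in>C. x\<^sup>c\<close> and
  \<open>B'\<close> its image under \<open>x \<mapsto> x\<^sup>-\<^sup>1\<close>. With \<open>R\<close> and \<open>N\<close> the sums over the residues and nonresidues
  and \<open>J = 1 + R + N\<close>, one has \<open>B B' = (n + R)(n + N)\<close> and \<open>R N = k (J - 1)\<close>. As \<open>n\<^sup>2 - n = 2k\<close>, this
  gives \<open>B B' = k + (n + k) J\<close>, so \<open>(x - 1) B B' = 0\<close> because \<open>q\<close> divides \<open>k\<close>.
  If the order of \<open>q\<close> is even, then \<open>q\<^sup>e = -1\<close> modulo \<open>p\<close> for some \<open>e\<close>, hence \<open>B' = B ^ (q ^ e)\<close> and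
  \<open>B = B ^ (q ^ (2 e))\<close>. Therefore \<open>(x - 1) B = 0\<close>, i.e. \<open>C\<close> is invariant under translation by 1,
  contradicting \<open>0 < n\<^sup>2 \<noteq> p\<close>.
\<close>

section \<open>The group ring of a cyclic group modulo a prime\<close>

text \<open>The inner binomial coefficients are multiples of q. A divisibility replaces the usual
  equality because integer polynomials have characteristic 0.\<close>

lemma freshmans_dream_dvd:
  fixes a b :: "'a::comm_ring_1"
  assumes "prime q"
  shows "of_nat q dvd (a + b) ^ q - (a ^ q + b ^ q)"
proof -
  have q0: "q > 0" using assms by (rule prime_gt_0_nat)
  have "(a + b) ^ q = (\<Sum>k\<le>q. of_nat (q choose k) * a ^ k * b ^ (q - k))"
    by (rule binomial_ring)
  also have "{..q} = insert 0 (insert q {0<..<q})" using q0 by auto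
  also have "(\<Sum>k\<in>\<dots>. of_nat (q choose k) * a ^ k * b ^ (q - k))
      = a ^ q + b ^ q + (\<Sum>k\<in>{0<..<q}. of_nat (q choose k) * a ^ k * b ^ (q - k))"
    using q0 by (simp add: algebra_simps)
  finally have eq: "(a + b) ^ q - (a ^ q + b ^ q)
      = (\<Sum>k\<in>{0<..<q}. of_nat (q choose k) * a ^ k * b ^ (q - k))"
    by simp
  show ?thesis
    unfolding eq
  proof (rule dvd_sum)
    fix k assume "k \<in> {0<..<q}"
    then have "q dvd (q choose k)" using assms by (intro dvd_choose_prime) auto
    then obtain m where "q choose k = q * m" ..
    then show "(of_nat q :: 'a) dvd of_nat (q choose k) * a ^ k * b ^ (q - k)"
      by (simp add: mult.assoc)
  qed
qed

locale cyclic_group_ring =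
  fixes p q :: nat
  assumes p_pos: "p > 0"
begin

text \<open>Congruence modulo the ideal generated by q and x^p - 1, kept as a relation on integer
  polynomials instead of a quotient type.\<close>

definition grp_cong :: "int poly \<Rightarrow> int poly \<Rightarrow> bool" (infix "\<approx>" 50)
  where "f \<approx> g \<longleftrightarrow> (\<exists>u v. f - g = of_nat q * u + (monom 1 p - 1) * v)"

lemma grp_cong_refl [simp, intro]: "f \<approx> f"
  unfolding grp_cong_def by (intro exI[of _ 0]) simp

lemma grp_cong_sym: "f \<approx> g \<Longrightarrow> g \<approx> f"
  unfolding grp_cong_def
proof clarify
  fix u v assume "f - g = of_nat q * u + (monom 1 p - 1) * v"
  then have "g - f = of_nat q * (- u) + (monom 1 p - 1) * (- v)"
    by (metis add_uminus_conv_diff minus_add_distrib minus_diff_eq mult_minus_right)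
  then show "\<exists>u v. g - f = of_nat q * u + (monom 1 p - 1) * v" by blast
qed

lemma grp_cong_add: "f \<approx> g \<Longrightarrow> f' \<approx> g' \<Longrightarrow> f + f' \<approx> g + g'"
  unfolding grp_cong_def
proof clarify
  fix u v u' v' assume "f - g = of_nat q * u + (monom 1 p - 1) * v"
    "f' - g' = of_nat q * u' + (monom 1 p - 1) * v'"
  then have "f + f' - (g + g') = of_nat q * (u + u') + (monom 1 p - 1) * (v + v')"
    by (simp add: algebra_simps)
  then show "\<exists>u v. f + f' - (g + g') = of_nat q * u + (monom 1 p - 1) * v" by blast
qed

lemma grp_cong_trans [trans]: "f \<approx> g \<Longrightarrow> g \<approx> h \<Longrightarrow> f \<approx> h"
  using grp_cong_add[of f g g h] by (simp add: grp_cong_def)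

lemma grp_cong_mult_left: "f \<approx> g \<Longrightarrow> h * f \<approx> h * g"
  unfolding grp_cong_def
proof clarify
  fix u v assume "f - g = of_nat q * u + (monom 1 p - 1) * v"
  then have "h * f - h * g = h * (of_nat q * u + (monom 1 p - 1) * v)"
    by (simp flip: right_diff_distrib)
  also have "\<dots> = of_nat q * (h * u) + (monom 1 p - 1) * (h * v)"
    by (simp add: algebra_simps)
  finally show "\<exists>u v. h * f - h * g = of_nat q * u + (monom 1 p - 1) * v" by blast
qed

lemma grp_cong_mult: "f \<approx> g \<Longrightarrow> f' \<approx> g' \<Longrightarrow> f * f' \<approx> g * g'"
  using grp_cong_mult_left[of f' g' f] grp_cong_mult_left[of f g g']
  by (metis grp_cong_trans mult.commute)

lemma grp_cong_power: "f \<approx> g \<Longrightarrow> f ^ k \<approx> g ^ k"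
  by (induction k) (auto intro: grp_cong_mult)

lemma grp_cong_sum: "(\<And>i. i \<in> I \<Longrightarrow> f i \<approx> g i) \<Longrightarrow> sum f I \<approx> sum g I"
  by (induction I rule: infinite_finite_induct) (auto intro: grp_cong_add)

lemma grp_cong_of_dvd:
  assumes "q dvd m"
  shows "of_nat m * f \<approx> 0"
proof -
  obtain l where "m = q * l" using assms ..
  then have "of_nat m * f - 0 = of_nat q * (of_nat l * f) + (monom 1 p - 1) * 0"
    by (simp add: mult.assoc)
  then show ?thesis unfolding grp_cong_def by blast
qed

lemma grp_cong_of_dvd_diff: "of_nat q dvd f - g \<Longrightarrow> f \<approx> g"
  unfolding grp_cong_def by (elim dvdE) (metis add.right_neutral mult_zero_right)

text \<open>The group element e as a monomial. Reducing the exponent admits negative e and makes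
  \<open>gen\<close> depend only on e modulo p, at the price that products agree only up to
  \<approx>.\<close>

definition gen :: "int \<Rightarrow> int poly"
  where "gen e = monom 1 (nat (e mod int p))"

lemma gen_cong: "[e = f] (mod int p) \<Longrightarrow> gen e = gen f"
  by (simp add: gen_def cong_def)

lemma gen_0 [simp]: "gen 0 = 1"
  by (simp add: gen_def)

lemma gen_mult: "gen e * gen f \<approx> gen (e + f)"
proof -
  define a b where "a = nat (e mod int p)" and "b = nat (f mod int p)"
  have ab: "e mod int p = int a" "f mod int p = int b"
    using p_pos by (auto simp: a_def b_def)
  have lt: "a < p" "b < p"
    using p_pos by (auto simp: a_def b_def nat_less_iff)
  have "(e + f) mod int p = (int a + int b) mod int p"
    by (metis ab mod_add_eq)
  also have "\<dots> = int ((a + b) mod p)" by (simp add: zmod_int)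
  finally have sum: "gen (e + f) = monom 1 ((a + b) mod p)" by (simp add: gen_def)
  have prod: "gen e * gen f = monom 1 (a + b)" by (simp add: gen_def a_def b_def mult_monom)
  show ?thesis
  proof (cases "a + b < p")
    case True
    then show ?thesis by (simp add: sum prod)
  next
    case False
    \<comment> \<open>A carry past p leaves a factor x^p, which is 1 modulo the ideal.\<close>
    then have "(a + b) mod p = a + b - p" using lt by (simp add: mod_if)
    moreover have "monom (1::int) (a + b) = monom 1 p * monom 1 (a + b - p)"
      using False by (simp add: mult_monom)
    ultimately have "gen e * gen f - gen (e + f)
        = of_nat q * 0 + (monom 1 p - 1) * monom 1 (a + b - p)"
      by (simp add: sum prod algebra_simps)
    then show ?thesis unfolding grp_cong_def by blast
  qed
qed

lemma gen_power: "gen e ^ k \<approx> gen (int k * e)"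
proof (induction k)
  case (Suc k)
  then have "gen e ^ Suc k \<approx> gen e * gen (int k * e)"
    by (simp add: grp_cong_mult_left)
  also have "\<dots> \<approx> gen (int (Suc k) * e)"
    using gen_mult[of e "int k * e"] by (simp add: algebra_simps)
  finally show ?case .
qed simp

section \<open>Frobenius on sums of group elements\<close>

lemma grp_cong_sum_power_prime:
  assumes "prime q"
  shows "(\<Sum>i\<in>I. f i) ^ q \<approx> (\<Sum>i\<in>I. f i ^ q)"
proof (induction I rule: infinite_finite_induct)
  case (insert x I)
  have "(\<Sum>i\<in>insert x I. f i) ^ q = (f x + (\<Sum>i\<in>I. f i)) ^ q"
    using insert by simp
  also have "\<dots> \<approx> f x ^ q + (\<Sum>i\<in>I. f i) ^ q"
    by (intro grp_cong_of_dvd_diff freshmans_dream_dvd assms)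
  also have "\<dots> \<approx> f x ^ q + (\<Sum>i\<in>I. f i ^ q)"
    using insert by (intro grp_cong_add) auto
  finally show ?case using insert by simp
\<comment> \<open>Empty and infinite index sets both sum to 0, and 0 ^ q = 0 because q is
  positive.\<close>
qed (use prime_gt_0_nat[OF assms] in \<open>auto simp: power_0_left\<close>)

text \<open>Each application of Frobenius multiplies all exponents by q, so these powers of a sum
  act as the substitutions x -> x^(q^k).\<close>

lemma sum_gen_power_prime_power:
  assumes "prime q"
  shows "(\<Sum>i\<in>I. gen (e i)) ^ (q ^ k) \<approx> (\<Sum>i\<in>I. gen (int q ^ k * e i))"
proof (induction k)
  case (Suc k)
  have "(\<Sum>i\<in>I. gen (e i)) ^ (q ^ Suc k) = ((\<Sum>i\<in>I. gen (e i)) ^ (q ^ k)) ^ q"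
    by (metis power_Suc2 power_mult)
  also have "\<dots> \<approx> (\<Sum>i\<in>I. gen (int q ^ k * e i)) ^ q"
    by (rule grp_cong_power) (rule Suc)
  also have "\<dots> \<approx> (\<Sum>i\<in>I. gen (int q ^ k * e i) ^ q)"
    by (rule grp_cong_sum_power_prime) (rule assms)
  also have "\<dots> \<approx> (\<Sum>i\<in>I. gen (int q * (int q ^ k * e i)))"
    by (intro grp_cong_sum gen_power)
  finally show ?case by (simp add: mult.assoc)
qed simp

section \<open>Coefficients of group elements\<close>

text \<open>Well defined modulo \<open>x\<^sup>p - 1\<close>: the coefficient of the group element \<open>c\<close>.\<close>

definition grp_coeff :: "nat \<Rightarrow> int poly \<Rightarrow> int"
  where "grp_coeff c f = (\<Sum>i\<le>degree f. if i mod p = c then coeff f i else 0)"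

lemma grp_coeff_altdef:
  "degree f \<le> N \<Longrightarrow> grp_coeff c f = (\<Sum>i\<le>N. if i mod p = c then coeff f i else 0)"
  unfolding grp_coeff_def by (rule sum.mono_neutral_left) (auto simp: coeff_eq_0)

lemma grp_coeff_add: "grp_coeff c (f + g) = grp_coeff c f + grp_coeff c g"
proof -
  define N where "N = max (degree f) (degree g)"
  have "degree f \<le> N" "degree g \<le> N" "degree (f + g) \<le> N"
    using degree_add_le_max[of f g] by (auto simp: N_def)
  then show ?thesis
    by (simp add: grp_coeff_altdef flip: sum.distrib) (rule sum.cong, auto)
qed

lemma grp_coeff_of_nat_mult: "grp_coeff c (of_nat m * f) = int m * grp_coeff c f"
proof -
  have eq: "of_nat m * f = smult (int m) f"
    by (simp add: of_nat_poly)
  have "grp_coeff c (smult (int m) f)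
      = (\<Sum>i\<le>degree f. if i mod p = c then coeff (smult (int m) f) i else 0)"
    by (rule grp_coeff_altdef) (rule degree_smult_le)
  also have "\<dots> = int m * grp_coeff c f"
    unfolding grp_coeff_def sum_distrib_left by (rule sum.cong) auto
  finally show ?thesis by (simp only: eq)
qed

lemma grp_coeff_0 [simp]: "grp_coeff c 0 = 0"
  by (simp add: grp_coeff_def cong: if_cong)

lemma grp_coeff_uminus: "grp_coeff c (- f) = - grp_coeff c f"
  using grp_coeff_add[of c f "- f"] by simp

lemma grp_coeff_sum: "grp_coeff c (\<Sum>i\<in>I. f i) = (\<Sum>i\<in>I. grp_coeff c (f i))"
  by (induction I rule: infinite_finite_induct) (auto simp: grp_coeff_add)

lemma grp_coeff_monom: "grp_coeff c (monom a i) = (if i mod p = c then a else 0)"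
proof -
  have "grp_coeff c (monom a i) = (\<Sum>j\<le>i. if j mod p = c then coeff (monom a i) j else 0)"
    by (rule grp_coeff_altdef) (rule degree_monom_le)
  also have "\<dots> = (\<Sum>j\<le>i. if j = i then (if i mod p = c then a else 0) else 0)"
    by (rule sum.cong) auto
  finally show ?thesis by simp
qed

text \<open>Adding p to an exponent leaves its class modulo p unchanged; hence
  \<open>grp_coeff\<close> vanishes on multiples of x^p - 1.\<close>

lemma grp_coeff_monom_mult: "grp_coeff c (monom 1 p * f) = grp_coeff c f"
proof -
  have "grp_coeff c (monom 1 p * f)
      = grp_coeff c (\<Sum>i\<le>degree f. monom (coeff f i) (p + i))"
    by (subst (1) poly_as_sum_of_monoms[symmetric]) (simp add: sum_distrib_left mult_monom)
  also have "\<dots> = grp_coeff c (\<Sum>i\<le>degree f. monom (coeff f i) i)"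
    by (simp add: grp_coeff_sum grp_coeff_monom)
  finally show ?thesis by (simp add: poly_as_sum_of_monoms)
qed

text \<open>The way back from the group ring to sets of residues: the multiple of x^p - 1
  contributes nothing, the other term a multiple of q.\<close>

lemma grp_cong_imp_grp_coeff_cong:
  assumes "f \<approx> g"
  shows "[grp_coeff c f = grp_coeff c g] (mod int q)"
proof -
  obtain u v where "f - g = of_nat q * u + (monom 1 p - 1) * v"
    using assms unfolding grp_cong_def by blast
  then have "f = g + (of_nat q * u + (monom 1 p * v + - v))"
    by (simp add: algebra_simps)
  then have "grp_coeff c f = grp_coeff c g + int q * grp_coeff c u"
    by (simp only: grp_coeff_add grp_coeff_of_nat_mult grp_coeff_monom_mult grp_coeff_uminus)
  then show ?thesis by (simp add: cong_iff_dvd_diff)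
qed

lemma grp_coeff_gen:
  "c < p \<Longrightarrow> grp_coeff c (gen e) = (if [e = int c] (mod int p) then 1 else 0)"
proof -
  assume c: "c < p"
  have "nat (e mod int p) < p" using p_pos by (simp add: nat_less_iff)
  moreover have "nat (e mod int p) = c \<longleftrightarrow> [e = int c] (mod int p)"
    using p_pos c by (auto simp: cong_def nat_eq_iff)
  ultimately show ?thesis by (simp add: gen_def grp_coeff_monom)
qed

end

section \<open>Quadratic residues\<close>

text \<open>Euler's criterion makes the Legendre symbol multiplicative modulo p, which lifts to an
  equality of integers.\<close>

lemma QuadRes_mult_iff:
  assumes "prime p" "2 < p" "\<not> int p dvd a" "\<not> int p dvd b"
  shows "QuadRes (int p) (a * b) \<longleftrightarrow> (QuadRes (int p) a \<longleftrightarrow> QuadRes (int p) b)"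
proof -
  have ab: "\<not> int p dvd a * b"
    using assms by (simp add: prime_dvd_mult_iff)
  have "[Legendre (a * b) p = (a * b) ^ ((p - 1) div 2)] (mod p)"
    using assms by (intro euler_criterion)
  also have "(a * b) ^ ((p - 1) div 2) = a ^ ((p - 1) div 2) * b ^ ((p - 1) div 2)"
    by (rule power_mult_distrib)
  also have "[\<dots> = Legendre a p * Legendre b p] (mod p)"
    using assms by (intro cong_mult cong_sym[OF euler_criterion])
  finally have "int p dvd Legendre (a * b) p - Legendre a p * Legendre b p"
    by (simp add: cong_iff_dvd_diff)
  \<comment> \<open>Both terms lie in {-1, 0, 1}, so they differ by at most 2, which is below
    p.\<close>
  moreover have "\<bar>Legendre (a * b) p - Legendre a p * Legendre b p\<bar> < int p"
    using assms(2) by (auto simp: Legendre_def)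
  ultimately have "Legendre (a * b) p = Legendre a p * Legendre b p"
    using dvd_imp_le_int[of "Legendre (a * b) p - Legendre a p * Legendre b p" "int p"] by linarith
  then show ?thesis
    using assms ab by (auto simp: Legendre_def cong_0_iff split: if_splits)
qed

lemma QuadRes_cong: "[a = b] (mod m) \<Longrightarrow> QuadRes m a \<longleftrightarrow> QuadRes m b"
  unfolding QuadRes_def using cong_sym cong_trans by blast

lemma mem_quad_res_set_mod_iff:
  assumes "prime p"
  shows "x mod int p \<in> quad_res_set p \<longleftrightarrow> \<not> int p dvd x \<and> QuadRes (int p) x"
proof -
  have p0: "int p > 0" using assms by (simp add: prime_gt_0_nat)
  have "QuadRes (int p) (x mod int p) \<longleftrightarrow> QuadRes (int p) x"
    by (rule QuadRes_cong) simp
  moreover have "x mod int p \<ge> 1 \<longleftrightarrow> \<not> int p dvd x"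
    using pos_mod_sign[OF p0, of x] by (simp only: dvd_eq_mod_eq_0) linarith
  ultimately show ?thesis
    using p0 by (auto simp: quad_res_set_def)
qed

text \<open>Squaring identifies 1 and p - 1, so it is not injective on the nonzero classes and
  therefore not surjective either.\<close>

lemma ex_quadratic_nonresidue:
  assumes "prime p" "2 < p"
  obtains r where "\<not> int p dvd r" "\<not> QuadRes (int p) r"
proof -
  have "\<exists>r\<in>{1..<int p}. \<not> QuadRes (int p) r"
  proof (rule ccontr)
    assume "\<not> ?thesis"
    then have res: "QuadRes (int p) r" if "r \<in> {1..<int p}" for r using that by blast
    define f where "f = (\<lambda>y. y\<^sup>2 mod int p)"
    have sub: "{1..<int p} \<subseteq> f ` {1..<int p}"
    proof
      fix r assume r: "r \<in> {1..<int p}"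
      then obtain y where y: "[y\<^sup>2 = r] (mod int p)" using res unfolding QuadRes_def by blast
      then have "f (y mod int p) = r"
        using r by (simp add: f_def power_mod cong_def)
      moreover have "y mod int p \<noteq> 0"
        using \<open>f (y mod int p) = r\<close> r by (auto simp: f_def)
      then have "y mod int p \<in> {1..<int p}"
        using assms(2) pos_mod_sign[of "int p" y] pos_mod_bound[of "int p" y]
        unfolding atLeastLessThan_iff by linarith
      ultimately show "r \<in> f ` {1..<int p}" by blast
    qed
    have "card (f ` {1..<int p}) = card {1..<int p}"
      by (intro le_antisym card_image_le card_mono sub) auto
    then have "inj_on f {1..<int p}" by (simp add: eq_card_imp_inj_on)
    moreover have "f 1 = f (int p - 1)"
      by (auto simp: f_def power2_eq_square algebra_simps mod_eq_dvd_iff)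
    ultimately show False using assms(2) by (auto dest: inj_onD)
  qed
  then obtain r where "1 \<le> r" "r < int p" "\<not> QuadRes (int p) r" by auto
  then show thesis using that[of r] by (meson int_one_le_iff_zero_less not_le zdvd_imp_le)
qed

definition quad_nonres_set :: "nat \<Rightarrow> int set"
  where "quad_nonres_set p = {x \<in> {1..<int p}. \<not> QuadRes (int p) x}"

lemma mem_quad_nonres_set_mod_iff:
  assumes "prime p"
  shows "x mod int p \<in> quad_nonres_set p \<longleftrightarrow> \<not> int p dvd x \<and> \<not> QuadRes (int p) x"
proof -
  have p0: "int p > 0" using assms by (simp add: prime_gt_0_nat)
  have "QuadRes (int p) (x mod int p) \<longleftrightarrow> QuadRes (int p) x"
    by (rule QuadRes_cong) simp
  moreover have "x mod int p \<ge> 1 \<longleftrightarrow> \<not> int p dvd x"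
    using pos_mod_sign[OF p0, of x] by (simp only: dvd_eq_mod_eq_0) linarith
  ultimately show ?thesis
    using p0 by (auto simp: quad_nonres_set_def)
qed

lemma quad_res_setD:
  assumes "s \<in> quad_res_set p"
  shows "s mod int p = s" "\<not> int p dvd s" "QuadRes (int p) s" "0 < s" "s < int p"
  using assms by (auto simp: quad_res_set_def dest: zdvd_imp_le)

lemma quad_nonres_setD:
  assumes "s \<in> quad_nonres_set p"
  shows "s mod int p = s" "\<not> int p dvd s" "\<not> QuadRes (int p) s" "0 < s" "s < int p"
  using assms by (auto simp: quad_nonres_set_def dest: zdvd_imp_le)

lemma finite_quad_res_set [simp]: "finite (quad_res_set p)" "finite (quad_nonres_set p)"
  by (rule finite_subset[of _ "{1..<int p}"]; auto simp: quad_res_set_def quad_nonres_set_def)+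

lemma residues_partition:
  assumes "p > 0"
  shows "{0..<int p} = insert 0 (quad_res_set p \<union> quad_nonres_set p)"
  using assms by (auto simp: quad_res_set_def quad_nonres_set_def)

lemma ex_inverse_mod_prime:
  assumes "prime p" "\<not> int p dvd a"
  obtains b where "[a * b = 1] (mod int p)" "\<not> int p dvd b"
proof -
  have "coprime (int p) a"
    using assms by (intro prime_imp_coprime) auto
  then obtain b where b: "[a * b = 1] (mod int p)"
    using cong_solve_coprime_int coprime_commute by blast
  have "\<not> int p dvd b"
  proof
    assume "int p dvd b"
    then have "int p dvd a * b" by simp
    then have "int p dvd 1" using b cong_dvd_iff by blast
    then show False using assms(1) by (simp add: prime_nat_iff)
  qed
  with b that show thesis by blast
qed

text \<open>Multiplication by r flips the quadratic character. The inverse r' of r is a nonresidue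
  too, since r r' is the square 1, so multiplication by r' flips it back.\<close>

lemma bij_betw_mult_nonresidue:
  assumes "prime p" "2 < p" "\<not> int p dvd r" "\<not> QuadRes (int p) r"
  shows "bij_betw (\<lambda>s. r * s mod int p) (quad_res_set p) (quad_nonres_set p)"
proof -
  have pint: "prime (int p)" using assms(1) by simp
  obtain r' where r': "[r * r' = 1] (mod int p)" "\<not> int p dvd r'"
    using ex_inverse_mod_prime assms by blast
  have "QuadRes (int p) (r * r')"
    using QuadRes_cong[OF r'(1)] by (auto simp: QuadRes_def intro!: exI[of _ 1])
  then have nr': "\<not> QuadRes (int p) r'"
    using QuadRes_mult_iff assms r' by blast
  have inv1: "r' * (r * s mod int p) mod int p = s mod int p" for s
  proof -
    have "[r' * (r * s mod int p) = (r * r') * s] (mod int p)"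
      by (simp add: cong_def mod_simps ac_simps)
    also have "[(r * r') * s = 1 * s] (mod int p)" by (intro cong_mult r') auto
    finally show ?thesis by (simp add: cong_def)
  qed
  have inv2: "r * (r' * s mod int p) mod int p = s mod int p" for s
  proof -
    have "[r * (r' * s mod int p) = (r * r') * s] (mod int p)"
      by (simp add: cong_def mod_simps ac_simps)
    also have "[(r * r') * s = 1 * s] (mod int p)" by (intro cong_mult r') auto
    finally show ?thesis by (simp add: cong_def)
  qed
  show ?thesis
  proof (rule bij_betw_byWitness[where f' = "\<lambda>t. r' * t mod int p"])
    show "\<forall>s\<in>quad_res_set p. r' * (r * s mod int p) mod int p = s"
      using inv1 by (auto simp: quad_res_setD)
    show "\<forall>t\<in>quad_nonres_set p. r * (r' * t mod int p) mod int p = t"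
      using inv2 by (auto simp: quad_nonres_setD)
    show "(\<lambda>s. r * s mod int p) ` quad_res_set p \<subseteq> quad_nonres_set p"
    proof clarify
      fix s assume "s \<in> quad_res_set p"
      note s = quad_res_setD[OF this]
      show "r * s mod int p \<in> quad_nonres_set p"
        using assms pint s QuadRes_mult_iff[OF assms(1,2,3) s(2)]
        by (simp add: mem_quad_nonres_set_mod_iff prime_dvd_mult_iff)
    qed
    show "(\<lambda>t. r' * t mod int p) ` quad_nonres_set p \<subseteq> quad_res_set p"
    proof clarify
      fix t assume "t \<in> quad_nonres_set p"
      note t = quad_nonres_setD[OF this]
      show "r' * t mod int p \<in> quad_res_set p"
        using assms pint t nr' QuadRes_mult_iff[OF assms(1,2) r'(2) t(2)] r'(2)
        by (simp add: mem_quad_res_set_mod_iff prime_dvd_mult_iff)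
    qed
  qed
qed

lemma card_quad_res_set:
  assumes "prime p" "2 < p"
  shows "2 * card (quad_res_set p) = p - 1" "card (quad_nonres_set p) = card (quad_res_set p)"
proof -
  obtain r where "\<not> int p dvd r" "\<not> QuadRes (int p) r"
    using ex_quadratic_nonresidue assms by blast
  from bij_betw_same_card[OF bij_betw_mult_nonresidue[OF assms this]]
  show *: "card (quad_nonres_set p) = card (quad_res_set p)" ..
  have "card {0..<int p} = Suc (card (quad_res_set p \<union> quad_nonres_set p))"
    using assms by (subst residues_partition, simp, subst card_insert_disjoint)
      (simp_all, simp add: quad_res_set_def quad_nonres_set_def)
  also have "card (quad_res_set p \<union> quad_nonres_set p) = 2 * card (quad_res_set p)"
    using * by (subst card_Un_disjoint)
      (simp_all, auto simp: quad_res_set_def quad_nonres_set_def)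
  finally show "2 * card (quad_res_set p) = p - 1" by simp
qed

section \<open>Representations as a residue plus a nonresidue\<close>

definition res_nonres_sums :: "nat \<Rightarrow> int \<Rightarrow> (int \<times> int) set"
  where "res_nonres_sums p c =
    {(s, t) \<in> quad_res_set p \<times> quad_nonres_set p. (s + t) mod int p = c mod int p}"

text \<open>Multiplication by a nonresidue swaps the two summands.\<close>

lemma card_res_nonres_sums_le:
  assumes "prime p" "2 < p" "\<not> int p dvd u"
  shows "card (res_nonres_sums p c) \<le> card (res_nonres_sums p (u * c))"
proof -
  have pint: "prime (int p)" using assms(1) by simp
  define f where "f = (\<lambda>(s, t). if QuadRes (int p) u then (u * s mod int p, u * t mod int p)
    else (u * t mod int p, u * s mod int p))"
  have cop: "coprime u (int p)"
    using prime_imp_coprime[OF pint] assms(3) by (simp add: coprime_commute)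
  have cancel: "s = t" if "u * s mod int p = u * t mod int p" "s mod int p = s" "t mod int p = t" for s t
  proof -
    have "[u * s = u * t] (mod int p)" using that(1) by (simp add: cong_def)
    then have "[s = t] (mod int p)"
      by (rule cong_mult_lcancel[OF cop, THEN iffD1])
    then show ?thesis using that by (simp add: cong_def)
  qed
  have "inj_on f (res_nonres_sums p c)"
  proof (rule inj_onI)
    fix z w assume zw: "z \<in> res_nonres_sums p c" "w \<in> res_nonres_sums p c" "f z = f w"
    obtain s t s' t' where [simp]: "z = (s, t)" "w = (s', t')" by (cases z, cases w)
    have *: "(s, t) \<in> res_nonres_sums p c" "(s', t') \<in> res_nonres_sums p c"
      and eq: "f (s, t) = f (s', t')" using zw by simp_all
    have "u * s mod int p = u * s' mod int p \<and> u * t mod int p = u * t' mod int p"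
      using eq by (auto simp: f_def split: if_splits)
    moreover have "s mod int p = s" "t mod int p = t" "s' mod int p = s'" "t' mod int p = t'"
      using * quad_res_setD(1) quad_nonres_setD(1) by (auto simp: res_nonres_sums_def)
    ultimately show "z = w" using cancel[of s s'] cancel[of t t'] by simp
  qed
  moreover have "f ` res_nonres_sums p c \<subseteq> res_nonres_sums p (u * c)"
  proof (rule image_subsetI)
    fix z assume z: "z \<in> res_nonres_sums p c"
    obtain s t where [simp]: "z = (s, t)" by (cases z)
    from z have s: "s \<in> quad_res_set p" and t: "t \<in> quad_nonres_set p"
      and c: "[s + t = c] (mod int p)"
      by (auto simp: res_nonres_sums_def cong_def)
    have "[u * (s + t) = u * c] (mod int p)" by (intro cong_mult c) simp
    then have "(u * s + u * t) mod int p = u * c mod int p"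
      "(u * t + u * s) mod int p = u * c mod int p"
      by (simp_all add: cong_def algebra_simps)
    then show "f z \<in> res_nonres_sums p (u * c)"
      using assms pint quad_res_setD[OF s] quad_nonres_setD[OF t]
      by (auto simp: f_def res_nonres_sums_def mem_quad_res_set_mod_iff mem_quad_nonres_set_mod_iff
          QuadRes_mult_iff prime_dvd_mult_iff mod_simps)
  qed
  moreover have "finite (res_nonres_sums p (u * c))"
    by (rule finite_subset[of _ "quad_res_set p \<times> quad_nonres_set p"]) (auto simp: res_nonres_sums_def)
  ultimately show ?thesis by (metis card_inj_on_le)
qed

text \<open>Scaling shows that all nonzero c have equally many representations, and 0 has none; the
  ((p - 1)/2)^2 pairs are therefore shared evenly among p - 1 classes.\<close>

lemma card_res_nonres_sums:
  assumes "prime p" "2 < p" and neg: "QuadRes (int p) (- 1)" and c: "c \<in> {0..<int p}"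
  shows "card (res_nonres_sums p c) = (if c = 0 then 0 else (p - 1) div 4)"
proof -
  have pint: "prime (int p)" using assms(1) by simp
  \<comment> \<open>As -1 is a residue, s = -t would give s and t the same character.\<close>
  have zero: "res_nonres_sums p 0 = {}"
  proof -
    have False if s: "s \<in> quad_res_set p" and t: "t \<in> quad_nonres_set p" and st: "int p dvd s + t" for s t
    proof -
      have "[s = (- 1) * t] (mod int p)" using st by (simp add: cong_iff_dvd_diff)
      then have "QuadRes (int p) ((- 1) * t)" using QuadRes_cong quad_res_setD(3)[OF s] by blast
      moreover have "\<not> int p dvd - 1" using assms(2) by simp
      ultimately show False
        using QuadRes_mult_iff[OF assms(1,2), of "- 1" t] neg quad_nonres_setD[OF t] by blast
    qed
    then show ?thesis by (auto simp: res_nonres_sums_def)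
  qed
  have le: "card (res_nonres_sums p x) \<le> card (res_nonres_sums p y)"
    if xy: "\<not> int p dvd x" "\<not> int p dvd y" for x y
  proof -
    obtain x' where x': "[x * x' = 1] (mod int p)" "\<not> int p dvd x'"
      using ex_inverse_mod_prime[OF assms(1) xy(1)] by blast
    \<comment> \<open>The factor y x' carries x to y, so scaling by it compares the two
      counts.\<close>
    have "[(x * x') * y = 1 * y] (mod int p)" by (intro cong_mult x') simp
    then have "res_nonres_sums p ((y * x') * x) = res_nonres_sums p y"
      by (simp add: res_nonres_sums_def cong_def ac_simps)
    then show ?thesis
      using card_res_nonres_sums_le[OF assms(1,2), of "y * x'" x] x' xy pint
      by (simp add: prime_dvd_mult_iff)
  qed
  define k where "k = card (res_nonres_sums p 1)"
  have k: "card (res_nonres_sums p x) = k" if "x \<in> {0..<int p} - {0}" for x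
  proof -
    have "\<not> int p dvd x" using that by (auto dest: zdvd_imp_le)
    moreover have "\<not> int p dvd 1" using assms(2) by simp
    ultimately show ?thesis unfolding k_def by (intro antisym le)
  qed
  define h where "h = card (quad_res_set p)"
  have h: "2 * h = p - 1" "card (quad_nonres_set p) = h"
    using card_quad_res_set assms by (auto simp: h_def)
  \<comment> \<open>Double counting of all pairs, grouped by their sum modulo p.\<close>
  have "h * h = card (quad_res_set p \<times> quad_nonres_set p)"
    using h by (simp add: card_cartesian_product h_def)
  also have "\<dots> = (\<Sum>x\<in>{0..<int p}. card {z \<in> quad_res_set p \<times> quad_nonres_set p. (fst z + snd z) mod int p = x})"
    unfolding card_eq_sum using assms by (subst sum.group) auto
  also have "\<dots> = (\<Sum>x\<in>{0..<int p}. card (res_nonres_sums p x))"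
    by (intro sum.cong arg_cong[of _ _ card]) (auto simp: res_nonres_sums_def)
  also have "\<dots> = (\<Sum>x\<in>{0..<int p} - {0}. card (res_nonres_sums p x))"
    by (rule sum.mono_neutral_right) (auto simp: zero)
  also have "\<dots> = (\<Sum>x\<in>{0..<int p} - {0}. k)" by (intro sum.cong refl k)
  also have "\<dots> = 2 * h * k" using h assms by (simp add: card_Diff_singleton)
  finally have "h * h = h * (2 * k)" by (simp add: ac_simps)
  moreover have "h > 0" using h(1) assms(2) by linarith
  ultimately have "h = 2 * k" by simp
  then have "(p - 1) div 4 = k" using h by simp
  then show ?thesis using k[of c] c zero by auto
qed

section \<open>Difference sets of quadratic residues\<close>

locale residue_difference_set = cyclic_group_ring p q for p q +
  fixes A :: "int set"
  assumes prime_p: "prime p" and A_subset: "A \<subseteq> {0..<int p}"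
    and exact: "diff_exact p A (quad_res_set p)"
begin

lemma finite_A [simp]: "finite A"
  using A_subset by (rule finite_subset) simp

lemma pint: "prime (int p)" using prime_p by simp

lemma diff_mem: "a \<in> A \<Longrightarrow> b \<in> A \<Longrightarrow> a \<noteq> b \<Longrightarrow> (a - b) mod int p \<in> quad_res_set p"
  using exact by (auto simp: diff_exact_def)

lemma diff_residue:
  assumes "a \<in> A" "b \<in> A" "a \<noteq> b"
  shows "\<not> int p dvd a - b" "QuadRes (int p) (a - b)"
  using mem_quad_res_set_mod_iff[OF prime_p, THEN iffD1, OF diff_mem[OF assms]] by blast+

lemma diff_unique:
  assumes "a \<in> A" "b \<in> A" "a' \<in> A" "b' \<in> A" "a \<noteq> b"
    and "(a - b) mod int p = (a' - b') mod int p"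
  shows "a = a' \<and> b = b'"
proof -
  have "\<exists>!(x, y). x \<in> A \<and> y \<in> A \<and> (x - y) mod int p = (a - b) mod int p"
    using exact diff_mem assms unfolding diff_exact_def by blast
  then obtain z where z: "\<And>w. (case w of (x, y) \<Rightarrow> x \<in> A \<and> y \<in> A \<and>
      (x - y) mod int p = (a - b) mod int p) \<Longrightarrow> w = z"
    by (elim ex1E) blast
  have "(a, b) = z" "(a', b') = z" using assms by (auto intro!: z)
  then show ?thesis by auto
qed

lemma diff_surj:
  assumes "s \<in> quad_res_set p"
  obtains a b where "a \<in> A" "b \<in> A" "a \<noteq> b" "(a - b) mod int p = s"
proof -
  have "\<exists>!(x, y). x \<in> A \<and> y \<in> A \<and> (x - y) mod int p = s"
    using exact assms unfolding diff_exact_def by blast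
  then obtain a b where ab: "a \<in> A" "b \<in> A" "(a - b) mod int p = s"
    by (elim ex1E) auto
  moreover have "a \<noteq> b" using ab quad_res_setD(4)[OF assms] by auto
  ultimately show thesis using that by blast
qed

text \<open>Everything comes from a representation a - b = 1 with a, b in A. The swapped difference
  -1 is a residue as well, and for p = 2 it would represent 1 a second time.\<close>

lemma p_gt_2: "p > 2" and minus_one: "QuadRes (int p) (- 1)"
proof -
  have "p \<ge> 2" using prime_p by (rule prime_ge_2_nat)
  then have "1 \<in> quad_res_set p"
    by (auto simp: quad_res_set_def QuadRes_def intro!: exI[of _ 1])
  then obtain a b where ab: "a \<in> A" "b \<in> A" "a \<noteq> b" "(a - b) mod int p = 1"
    by (rule diff_surj)
  have "p \<noteq> 2"
  proof
    assume "p = 2"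
    then have "(a - b) mod int p = (b - a) mod int p" by simp presburger
    then show False using diff_unique[of a b b a] ab by auto
  qed
  then show "p > 2" using \<open>p \<ge> 2\<close> by simp
  have "QuadRes (int p) (b - a)"
    using diff_residue(2)[of b a] ab by simp
  moreover have "[a - b = 1] (mod int p)" using ab \<open>p \<ge> 2\<close> by (simp add: cong_def)
  then have "[b - a = - 1] (mod int p)"
    by (metis cong_minus_minus_iff minus_diff_eq)
  ultimately show "QuadRes (int p) (- 1)" using QuadRes_cong by blast
qed

text \<open>Euler's criterion at -1: an odd exponent (p - 1)/2 would give 1 = -1 modulo p. This
  makes \<open>(p - 1) div 4\<close> an exact quotient.\<close>

lemma four_dvd: "4 dvd p - 1"
proof -
  have "[Legendre (- 1) p = (- 1) ^ ((p - 1) div 2)] (mod p)"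
    by (intro euler_criterion prime_p p_gt_2)
  moreover have "Legendre (- 1) p = 1"
    using minus_one p_gt_2 by (auto simp: Legendre_def cong_0_iff)
  ultimately have *: "[1 = (- 1) ^ ((p - 1) div 2)] (mod int p)" by simp
  have "even ((p - 1) div 2)"
  proof (rule ccontr)
    assume "odd ((p - 1) div 2)"
    then have "int p dvd 2" using * by (simp add: cong_iff_dvd_diff)
    then show False using p_gt_2 zdvd_imp_le by fastforce
  qed
  moreover have "odd p" using prime_p p_gt_2 prime_odd_nat by blast
  ultimately show ?thesis by presburger
qed

section \<open>Counting and group ring identities for A\<close>

lemma bij_betw_diff:
  "bij_betw (\<lambda>(a, b). (a - b) mod int p) {(a, b) \<in> A \<times> A. a \<noteq> b} (quad_res_set p)"
  unfolding bij_betw_def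
proof
  show "inj_on (\<lambda>(a, b). (a - b) mod int p) {(a, b) \<in> A \<times> A. a \<noteq> b}"
  proof (rule inj_onI)
    fix z w assume zw: "z \<in> {(a, b) \<in> A \<times> A. a \<noteq> b}" "w \<in> {(a, b) \<in> A \<times> A. a \<noteq> b}"
      and eq: "(case z of (a, b) \<Rightarrow> (a - b) mod int p) = (case w of (a, b) \<Rightarrow> (a - b) mod int p)"
    obtain a b a' b' where [simp]: "z = (a, b)" "w = (a', b')" by (cases z, cases w)
    show "z = w" using diff_unique[of a b a' b'] zw eq by simp
  qed
  show "(\<lambda>(a, b). (a - b) mod int p) ` {(a, b) \<in> A \<times> A. a \<noteq> b} = quad_res_set p"
  proof
    show "(\<lambda>(a, b). (a - b) mod int p) ` {(a, b) \<in> A \<times> A. a \<noteq> b} \<subseteq> quad_res_set p"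
      using diff_mem by auto
    show "quad_res_set p \<subseteq> (\<lambda>(a, b). (a - b) mod int p) ` {(a, b) \<in> A \<times> A. a \<noteq> b}"
    proof
      fix s assume "s \<in> quad_res_set p"
      then obtain a b where "a \<in> A" "b \<in> A" "a \<noteq> b" "(a - b) mod int p = s" by (rule diff_surj)
      then show "s \<in> (\<lambda>(a, b). (a - b) mod int p) ` {(a, b) \<in> A \<times> A. a \<noteq> b}"
        by (intro image_eqI[of _ _ "(a, b)"]) auto
    qed
  qed
qed

text \<open>The diagonal of A \<times> A gives \<open>card A\<close> pairs; the remaining pairs
  correspond to the residues.\<close>

lemma card_A: "card A * card A = card A + (p - 1) div 2"
proof -
  have "card A * card A = card (A \<times> A)" by (simp add: card_cartesian_product)
  also have "A \<times> A = (\<lambda>a. (a, a)) ` A \<union> {(a, b) \<in> A \<times> A. a \<noteq> b}" by auto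
  also have "card \<dots> = card ((\<lambda>a. (a, a)) ` A) + card {(a, b) \<in> A \<times> A. a \<noteq> b}"
    by (rule card_Un_disjoint) (auto intro: finite_subset[of _ "A \<times> A"])
  also have "card ((\<lambda>a. (a, a)) ` A) = card A" by (rule card_image) (auto simp: inj_on_def)
  also have "card {(a, b) \<in> A \<times> A. a \<noteq> b} = card (quad_res_set p)"
    using bij_betw_diff by (rule bij_betw_same_card)
  finally show ?thesis using card_quad_res_set[OF prime_p p_gt_2] by simp
qed

text \<open>The difference condition in the group ring: diagonal pairs give the constant, the others
  each residue once. The dilation u is later taken to be 1 and a nonresidue.\<close>

lemma sum_gen_mult_inverse:
  "(\<Sum>a\<in>A. gen (u * a)) * (\<Sum>b\<in>A. gen (- (u * b))) \<approx> of_nat (card A) + (\<Sum>s\<in>quad_res_set p. gen (u * s))"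
proof -
  have "(\<Sum>a\<in>A. gen (u * a)) * (\<Sum>b\<in>A. gen (- (u * b)))
      = (\<Sum>(a, b)\<in>A \<times> A. gen (u * a) * gen (- (u * b)))"
    by (simp add: sum_product sum.cartesian_product)
  also have "\<dots> \<approx> (\<Sum>(a, b)\<in>A \<times> A. gen (u * a + - (u * b)))"
    by (intro grp_cong_sum) (auto intro: gen_mult simp del: add_uminus_conv_diff)
  also have "A \<times> A = (\<lambda>a. (a, a)) ` A \<union> {(a, b) \<in> A \<times> A. a \<noteq> b}" by auto
  also have "(\<Sum>(a, b)\<in>\<dots>. gen (u * a + - (u * b)))
      = (\<Sum>(a, b)\<in>(\<lambda>a. (a, a)) ` A. gen (u * a + - (u * b)))
        + (\<Sum>(a, b)\<in>{(a, b) \<in> A \<times> A. a \<noteq> b}. gen (u * a + - (u * b)))"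
    by (rule sum.union_disjoint) (auto intro: finite_subset[of _ "A \<times> A"])
  also have "(\<Sum>(a, b)\<in>(\<lambda>a. (a, a)) ` A. gen (u * a + - (u * b))) = of_nat (card A)"
    by (subst sum.reindex) (auto simp: inj_on_def)
  also have "(\<Sum>(a, b)\<in>{(a, b) \<in> A \<times> A. a \<noteq> b}. gen (u * a + - (u * b)))
      = (\<Sum>z\<in>{(a, b) \<in> A \<times> A. a \<noteq> b}. gen (u * (\<lambda>(a, b). (a - b) mod int p) z))"
    by (rule sum.cong) (auto intro!: gen_cong simp: cong_def mod_simps algebra_simps)
  also have "\<dots> = (\<Sum>s\<in>quad_res_set p. gen (u * s))"
    using bij_betw_diff by (rule sum.reindex_bij_betw)
  finally show ?thesis .
qed

text \<open>The coefficient of \<open>gen c\<close> in the product counts the pairs in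
  \<open>res_nonres_sums p c\<close>, which is constant off c = 0.\<close>

lemma sum_gen_res_mult_nonres:
  "(\<Sum>s\<in>quad_res_set p. gen s) * (\<Sum>t\<in>quad_nonres_set p. gen t)
    \<approx> of_nat ((p - 1) div 4) * ((\<Sum>c\<in>{0..<int p}. gen c) - 1)"
proof -
  let ?Z = "quad_res_set p \<times> quad_nonres_set p"
  have "(\<Sum>s\<in>quad_res_set p. gen s) * (\<Sum>t\<in>quad_nonres_set p. gen t)
      = (\<Sum>z\<in>?Z. gen (fst z) * gen (snd z))"
    by (simp add: sum_product sum.cartesian_product split_def)
  also have "\<dots> \<approx> (\<Sum>z\<in>?Z. gen (fst z + snd z))"
    by (intro grp_cong_sum gen_mult)
  also have "\<dots> = (\<Sum>c\<in>{0..<int p}. \<Sum>z\<in>{z \<in> ?Z. (fst z + snd z) mod int p = c}. gen (fst z + snd z))"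
    using p_pos by (subst sum.group) auto
  also have "\<dots> = (\<Sum>c\<in>{0..<int p}. of_nat (card (res_nonres_sums p c)) * gen c)"
  proof (rule sum.cong)
    fix c assume c: "c \<in> {0..<int p}"
    have "{z \<in> ?Z. (fst z + snd z) mod int p = c} = res_nonres_sums p c"
      using c by (auto simp: res_nonres_sums_def)
    moreover have "(\<Sum>z\<in>res_nonres_sums p c. gen (fst z + snd z)) = (\<Sum>z\<in>res_nonres_sums p c. gen c)"
      by (rule sum.cong) (auto simp: res_nonres_sums_def cong_def intro!: gen_cong)
    ultimately show "(\<Sum>z\<in>{z \<in> ?Z. (fst z + snd z) mod int p = c}. gen (fst z + snd z))
        = of_nat (card (res_nonres_sums p c)) * gen c"
      by simp
  qed simp
  also have "\<dots> = (\<Sum>c\<in>{0..<int p}. of_nat (if c = 0 then 0 else (p - 1) div 4) * gen c)"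
    by (intro sum.cong) (auto simp: card_res_nonres_sums[OF prime_p p_gt_2 minus_one])
  also have "\<dots> = of_nat ((p - 1) div 4) * (\<Sum>c\<in>{0..<int p} - {0}. gen c)"
    unfolding sum_distrib_left by (rule sum.mono_neutral_cong_right) auto
  also have "(\<Sum>c\<in>{0..<int p} - {0}. gen c) = (\<Sum>c\<in>{0..<int p}. gen c) - 1"
    using p_pos by (subst sum_diff1) auto
  finally show ?thesis .
qed

text \<open>A coincidence gives a - a' = r (b' - b). If b and b' differ, the right side is a
  nonresidue, while the left is 0 or a residue.\<close>

lemma mixed_sums_inj:
  assumes "\<not> int p dvd r" "\<not> QuadRes (int p) r"
  shows "inj_on (\<lambda>(a, b). (a + r * b) mod int p) (A \<times> A)"
proof (rule inj_onI)
  fix z w assume zw: "z \<in> A \<times> A" "w \<in> A \<times> A"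
    and eq: "(case z of (a, b) \<Rightarrow> (a + r * b) mod int p) = (case w of (a, b) \<Rightarrow> (a + r * b) mod int p)"
  obtain a b a' b' where z [simp]: "z = (a, b)" "w = (a', b')" by (cases z, cases w)
  have mem: "a \<in> A" "b \<in> A" "a' \<in> A" "b' \<in> A" using zw by auto
  have cong: "[a - a' = r * (b' - b)] (mod int p)"
    using eq by (simp add: cong_iff_dvd_diff mod_eq_dvd_iff algebra_simps)
  have eq_if_dvd: "x = y" if "x \<in> A" "y \<in> A" "int p dvd x - y" for x y
    using that diff_residue(1) by blast
  have "b = b'"
  proof (rule ccontr)
    assume "b \<noteq> b'"
    then have b: "\<not> int p dvd b' - b" "QuadRes (int p) (b' - b)"
      using diff_residue mem by blast+
    then have "\<not> int p dvd r * (b' - b)" "\<not> QuadRes (int p) (r * (b' - b))"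
      using QuadRes_mult_iff[OF prime_p p_gt_2 assms(1) b(1)] assms pint
      by (simp_all only: prime_dvd_mult_iff) blast+
    then have "\<not> int p dvd a - a'" "\<not> QuadRes (int p) (a - a')"
      using cong_dvd_iff[OF cong] QuadRes_cong[OF cong] by blast+
    then show False
      using diff_residue(2)[of a a'] mem by (cases "a = a'") auto
  qed
  then have "int p dvd a - a'" using cong by (simp add: cong_iff_dvd_diff)
  then have "a = a'" using eq_if_dvd mem by blast
  then show "z = w" using \<open>b = b'\<close> by simp
qed

lemma sum_mult_gen_minus_one: "(\<Sum>c\<in>{0..<int p}. gen c) * (gen 1 - 1) \<approx> 0"
proof -
  have "(\<Sum>c\<in>{0..<int p}. gen c) * gen 1 \<approx> (\<Sum>c\<in>{0..<int p}. gen (c + 1))"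
    unfolding sum_distrib_right by (intro grp_cong_sum gen_mult)
  also have "\<dots> = (\<Sum>c\<in>{1..<int p + 1}. gen c)"
    by (rule sum.reindex_bij_witness[of _ "\<lambda>c. c - 1" "\<lambda>c. c + 1"]) auto
  \<comment> \<open>After the shift only the exponent p lies outside the standard range, and it
    wraps to 0.\<close>
  also have "{1..<int p + 1} = insert (int p) {1..<int p}" using p_pos by auto
  also have "sum gen \<dots> = gen (int p) + sum gen {1..<int p}" by simp
  also have "gen (int p) = gen 0" by (rule gen_cong) (simp add: cong_def)
  also have "gen 0 + sum gen {1..<int p} = sum gen (insert 0 {1..<int p})" by simp
  also have "insert 0 {1..<int p} = {0..<int p}" using p_pos by auto
  finally have "(\<Sum>c\<in>{0..<int p}. gen c) * gen 1 + - (\<Sum>c\<in>{0..<int p}. gen c)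
      \<approx> (\<Sum>c\<in>{0..<int p}. gen c) + - (\<Sum>c\<in>{0..<int p}. gen c)"
    by (rule grp_cong_add) simp
  then show ?thesis by (simp add: algebra_simps)
qed

lemma mixed_sums_product:
  assumes "q dvd (p - 1) div 4" and r: "\<not> int p dvd r" "\<not> QuadRes (int p) r"
  defines "C \<equiv> (\<lambda>(a, b). (a + r * b) mod int p) ` (A \<times> A)"
  shows "(\<Sum>c\<in>C. gen c) * (\<Sum>c\<in>C. gen (- c)) * (gen 1 - 1) \<approx> 0"
proof -
  define F where "F u = (\<Sum>a\<in>A. gen (u * a))" for u
  define G where "G = (\<Sum>s\<in>quad_res_set p. gen s)"
  define H where "H = (\<Sum>t\<in>quad_nonres_set p. gen t)"
  define J where "J = (\<Sum>c\<in>{0..<int p}. gen c)"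
  define k where "k = (p - 1) div 4"
  \<comment> \<open>Injectivity lets the sum over C factor. The value v = 1 gives B, and v = -1
    gives B'.\<close>
  have sum_C: "(\<Sum>c\<in>C. gen (v * c)) \<approx> F v * F (v * r)" for v
  proof -
    have "(\<Sum>c\<in>C. gen (v * c)) = (\<Sum>(a, b)\<in>A \<times> A. gen (v * ((a + r * b) mod int p)))"
      unfolding C_def using mixed_sums_inj[OF r] by (subst sum.reindex) (auto simp: split_def)
    also have "\<dots> = (\<Sum>(a, b)\<in>A \<times> A. gen (v * a + v * r * b))"
      by (intro sum.cong) (auto intro!: gen_cong simp: cong_def mod_simps algebra_simps)
    also have "\<dots> \<approx> (\<Sum>(a, b)\<in>A \<times> A. gen (v * a) * gen (v * r * b))"
      by (intro grp_cong_sum) (auto intro!: grp_cong_sym[OF gen_mult])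
    also have "\<dots> = F v * F (v * r)"
      by (simp add: F_def sum_product sum.cartesian_product)
    finally show ?thesis .
  qed
  have F: "F u * F (- u) \<approx> of_nat (card A) + (\<Sum>s\<in>quad_res_set p. gen (u * s))" for u
    using sum_gen_mult_inverse[of u] by (simp add: F_def)
  have "(\<Sum>s\<in>quad_res_set p. gen (r * s)) = (\<Sum>s\<in>quad_res_set p. gen (r * s mod int p))"
    by (intro sum.cong gen_cong) (auto simp: cong_def)
  also have "\<dots> = H" unfolding H_def
    using bij_betw_mult_nonresidue[OF prime_p p_gt_2 r] by (rule sum.reindex_bij_betw)
  finally have Fr: "F r * F (- r) \<approx> of_nat (card A) + H" using F[of r] by simp
  have F1: "F 1 * F (- 1) \<approx> of_nat (card A) + G" using F[of 1] by (simp add: G_def)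
  have "J = 1 + (G + H)"
  proof -
    have "J = (\<Sum>c\<in>quad_res_set p \<union> quad_nonres_set p. gen c) + gen 0"
      unfolding J_def residues_partition[OF p_pos]
      by (subst sum.insert) (auto dest: quad_res_setD quad_nonres_setD)
    also have "(\<Sum>c\<in>quad_res_set p \<union> quad_nonres_set p. gen c) = G + H"
      unfolding G_def H_def
      by (rule sum.union_disjoint) (auto dest: quad_res_setD quad_nonres_setD)
    finally show ?thesis by simp
  qed
  have GH: "G * H \<approx> of_nat k * (J - 1)"
    using sum_gen_res_mult_nonres by (simp add: G_def H_def J_def k_def)
  have "card A * card A = card A + 2 * k"
    using card_A four_dvd by (auto simp: k_def)
  then have n: "(of_nat (card A) :: int poly) * of_nat (card A) = of_nat (card A) + 2 * of_nat k"
    by (metis of_nat_add of_nat_mult of_nat_numeral)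
  have "(\<Sum>c\<in>C. gen c) * (\<Sum>c\<in>C. gen (- c)) \<approx> (F 1 * F r) * (F (- 1) * F (- r))"
    using grp_cong_mult[OF sum_C[of 1] sum_C[of "- 1"]] by simp
  \<comment> \<open>Each factor is paired with its image under inversion, where the difference
    condition applies.\<close>
  also have "\<dots> = (F 1 * F (- 1)) * (F r * F (- r))" by (simp only: ac_simps)
  also have "\<dots> \<approx> (of_nat (card A) + G) * (of_nat (card A) + H)"
    by (rule grp_cong_mult[OF F1 Fr])
  also have "\<dots> = of_nat (card A) * of_nat (card A) + of_nat (card A) * (G + H) + G * H"
    by (simp add: algebra_simps)
  also have "\<dots> \<approx> of_nat (card A) * of_nat (card A) + of_nat (card A) * (G + H) + of_nat k * (J - 1)"
    by (intro grp_cong_add GH) simp_all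
  \<comment> \<open>With n = \<open>card A\<close> and G + H = J - 1, the constant part is n^2 - n -
    k = k.\<close>
  also have "\<dots> = of_nat k * 1 + of_nat (card A + k) * J"
    unfolding n \<open>J = 1 + (G + H)\<close> by (simp add: algebra_simps)
  also have "\<dots> \<approx> 0 + of_nat (card A + k) * J"
    using assms(1) by (intro grp_cong_add grp_cong_of_dvd) (simp_all add: k_def)
  finally have "(\<Sum>c\<in>C. gen c) * (\<Sum>c\<in>C. gen (- c)) * (gen 1 - 1)
      \<approx> of_nat (card A + k) * J * (gen 1 - 1)"
    unfolding add_0 by (rule grp_cong_mult) (rule grp_cong_refl)
  also have "\<dots> = of_nat (card A + k) * (J * (gen 1 - 1))" by (simp only: ac_simps)
  also have "\<dots> \<approx> of_nat (card A + k) * 0"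
    unfolding J_def by (rule grp_cong_mult_left) (rule sum_mult_gen_minus_one)
  finally show ?thesis by simp
qed

text \<open>Inversion is then a power of Frobenius, so B' is a power of B up to \<approx> and the
  product identity becomes a statement about B alone.\<close>

lemma no_power_eq_minus_one:
  assumes q: "prime q" "q dvd (p - 1) div 4" and e: "e > 0" "[int q ^ e = - 1] (mod int p)"
  shows False
proof -
  obtain r where r: "\<not> int p dvd r" "\<not> QuadRes (int p) r"
    using ex_quadratic_nonresidue prime_p p_gt_2 by blast
  define C where "C = (\<lambda>(a, b). (a + r * b) mod int p) ` (A \<times> A)"
  define B where "B = (\<Sum>c\<in>C. gen c)"
  have C: "C \<subseteq> {0..<int p}" using p_pos by (auto simp: C_def)
  have finC: "finite C" by (simp add: C_def)
  have "gen (int q ^ e * c) = gen (- c)" for c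
    using cong_mult[OF e(2) cong_refl[of c]] by (intro gen_cong) simp
  then have conj: "B ^ (q ^ e) \<approx> (\<Sum>c\<in>C. gen (- c))"
    using sum_gen_power_prime_power[OF q(1), of "\<lambda>c. c" C e]
    by (simp add: B_def)
  have "[int q ^ (2 * e) = 1] (mod int p)"
    using cong_mult[OF e(2) e(2)] by (simp add: mult_2 power_add)
  then have "gen (int q ^ (2 * e) * c) = gen c" for c
    using cong_mult[OF _ cong_refl[of c]] by (intro gen_cong) fastforce
  then have fixed: "B ^ (q ^ (2 * e)) \<approx> B"
    using sum_gen_power_prime_power[OF q(1), of "\<lambda>c. c" C "2 * e"] by (simp add: B_def)
  \<comment> \<open>The goal is q^(2e) > q^e, so that \<open>B ^ (q ^ (2 * e))\<close> has B times
    \<open>B ^ (q ^ e)\<close> as a factor; this is where e > 0 enters.\<close>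
  have "q \<ge> 2" using q(1) by (rule prime_ge_2_nat)
  have "q ^ 1 \<le> q ^ e" using e(1) \<open>q \<ge> 2\<close> by (intro power_increasing) auto
  then have "2 * q ^ e \<le> q ^ e * q ^ e" using \<open>q \<ge> 2\<close> by (intro mult_right_mono) auto
  moreover have "q ^ e \<ge> 1" using \<open>q \<ge> 2\<close> by simp
  ultimately have "q ^ (2 * e) \<ge> Suc (q ^ e)" unfolding mult_2 power_add by linarith
  then obtain l where l: "q ^ (2 * e) = l + Suc (q ^ e)"
    using le_Suc_ex add.commute by metis
  have "(gen 1 - 1) * B \<approx> (gen 1 - 1) * B ^ (q ^ (2 * e))"
    by (intro grp_cong_mult_left grp_cong_sym[OF fixed])
  also have "\<dots> = B ^ l * (gen 1 - 1) * B * B ^ (q ^ e)"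
    unfolding l power_add power_Suc by (simp only: ac_simps)
  also have "\<dots> \<approx> B ^ l * (gen 1 - 1) * B * (\<Sum>c\<in>C. gen (- c))"
    by (intro grp_cong_mult_left conj)
  also have "\<dots> = B ^ l * (B * (\<Sum>c\<in>C. gen (- c)) * (gen 1 - 1))"
    by (simp only: ac_simps)
  also have "\<dots> \<approx> B ^ l * 0"
    unfolding B_def C_def by (intro grp_cong_mult_left mixed_sums_product[OF q(2) r])
  finally have "(gen 1 - 1) * B + B \<approx> B"
    using grp_cong_add[of _ 0 B B] by simp
  then have shift: "gen 1 * B \<approx> B" by (simp add: algebra_simps)
  have "(\<Sum>c\<in>C. gen (1 + c)) \<approx> gen 1 * B"
    unfolding B_def sum_distrib_left by (intro grp_cong_sum grp_cong_sym[OF gen_mult])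
  also note shift
  finally have "(\<Sum>c\<in>C. gen (1 + c)) \<approx> (\<Sum>c\<in>C. gen c)" by (simp add: B_def)
  then have coeff_eq: "[grp_coeff m (\<Sum>c\<in>C. gen (1 + c)) = grp_coeff m (\<Sum>c\<in>C. gen c)] (mod int q)" for m
    by (rule grp_cong_imp_grp_coeff_cong)
  \<comment> \<open>The shift j = 1 gives the translate of C, and j = 0 gives C itself.\<close>
  have coeff: "grp_coeff m (\<Sum>c\<in>C. gen (j + c)) = (if (int m - j) mod int p \<in> C then 1 else 0)"
    if "m < p" for m j
  proof -
    have "grp_coeff m (\<Sum>c\<in>C. gen (j + c)) = (\<Sum>c\<in>C. if c = (int m - j) mod int p then 1 else 0)"
      unfolding grp_coeff_sum
    proof (rule sum.cong)
      fix c assume "c \<in> C"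
      then have "c mod int p = c" using C by (simp add: subset_iff)
      have "[j + c = int m] (mod int p) \<longleftrightarrow> [c = int m - j] (mod int p)"
        by (simp add: cong_iff_dvd_diff algebra_simps)
      also have "\<dots> \<longleftrightarrow> c = (int m - j) mod int p"
        using \<open>c mod int p = c\<close> by (simp add: cong_def)
      finally show "grp_coeff m (gen (j + c)) = (if c = (int m - j) mod int p then 1 else 0)"
        using that by (simp add: grp_coeff_gen)
    qed simp
    then show ?thesis using finC by simp
  qed
  have step: "(int m - 1) mod int p \<in> C \<longleftrightarrow> int m \<in> C" if "m < p" for m
  proof -
    \<comment> \<open>The coefficients are 0 or 1, so congruence modulo q \<ge> 2 forces
      equality.\<close>
    have "\<not> int q dvd 1" "\<not> int q dvd - 1" using \<open>q \<ge> 2\<close> by auto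
    then show ?thesis
      using coeff_eq[of m] coeff[OF that, of 1] coeff[OF that, of 0] that
      by (auto simp: cong_iff_dvd_diff split: if_splits)
  qed
  \<comment> \<open>Membership is constant along 0, 1, ..., p - 1, leaving only the empty set and
    the whole group.\<close>
  have iff: "int m \<in> C \<longleftrightarrow> 0 \<in> C" if "m < p" for m
    using that
  proof (induction m)
    case (Suc m)
    then show ?case using step[of "Suc m"] by simp
  qed simp
  have "C = {} \<or> C = {0..<int p}"
  proof (cases "0 \<in> C")
    case True
    have "x \<in> C" if "x \<in> {0..<int p}" for x
      using iff[of "nat x"] True that by (simp add: nat_less_iff)
    then show ?thesis using C by blast
  next
    case False
    have "x \<notin> C" if "x \<in> {0..<int p}" for x
      using iff[of "nat x"] False that by (simp add: nat_less_iff)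
    then show ?thesis using C by blast
  qed
  then have "card C = 0 \<or> card C = p" by auto
  moreover have "card C = card A * card A"
    unfolding C_def using mixed_sums_inj[OF r] by (simp add: card_image card_cartesian_product)
  ultimately have "card A * card A = 0 \<or> card A * card A = p" by simp
  \<comment> \<open>A prime is not a square.\<close>
  moreover have "card A * card A \<noteq> p"
    using prime_p prime_product by (metis mult_1 not_prime_1)
  moreover have "card A * card A \<noteq> 0" using card_A p_gt_2 by auto
  ultimately show False by blast
qed

end

section \<open>From an even order to a power of q equal to -1\<close>

theorem theorem4:
  fixes p :: nat
  assumes "prime p"
    and "\<exists>A. A \<subseteq> {0..<int p} \<and> diff_exact p A (quad_res_set p)"
  shows "\<forall>q::nat. prime q \<and> q dvd (p - 1) div 4 \<longrightarrow> odd (ord p q)"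
proof (intro allI impI, elim conjE)
  fix q :: nat assume q: "prime q" "q dvd (p - 1) div 4"
  obtain A where "A \<subseteq> {0..<int p}" "diff_exact p A (quad_res_set p)"
    using assms(2) by blast
  then interpret residue_difference_set p q A
    using assms(1) by unfold_locales (auto simp: prime_gt_0_nat)
  \<comment> \<open>Positivity of the quotient bounds q below p. Coprimality matters because
    \<open>ord\<close> defaults to 0, an even number, otherwise.\<close>
  have "(p - 1) div 4 > 0" using four_dvd p_gt_2 by (auto elim!: dvdE)
  then have "q < p" using dvd_imp_le[OF q(2)] by linarith
  then have cop: "coprime p q" using assms(1) q(1) by (intro primes_coprime) auto
  show "odd (ord p q)"
  proof
    assume "even (ord p q)"
    then obtain e where e: "ord p q = 2 * e" ..
    have "e > 0" using cop e by (metis ord_gt_0_iff nat_0_less_mult_iff)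
    \<comment> \<open>By minimality of the order, q^e is not 1, but its square is; modulo a prime it
      must be -1.\<close>
    have "[q ^ e \<noteq> 1] (mod p)"
      using ord_minimal[of e p q] \<open>e > 0\<close> e by simp
    then have n1: "\<not> [int q ^ e = 1] (mod int p)"
      by (metis cong_int_iff of_nat_1 of_nat_power)
    have "[q ^ (2 * e) = 1] (mod p)" using ord[of q p] e by simp
    then have "[int (q ^ (2 * e)) = int 1] (mod int p)" by (simp only: cong_int_iff)
    moreover have "(int q ^ e - 1) * (int q ^ e + 1) = int q ^ (2 * e) - 1"
      unfolding mult_2 power_add by (simp add: algebra_simps)
    ultimately have "int p dvd (int q ^ e - 1) * (int q ^ e + 1)"
      by (simp add: cong_iff_dvd_diff)
    then have "int p dvd int q ^ e + 1"
      using n1 pint by (simp add: prime_dvd_mult_iff cong_iff_dvd_diff)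
    then have "[int q ^ e = - 1] (mod int p)" by (simp add: cong_iff_dvd_diff)
    then show False using no_power_eq_minus_one q \<open>e > 0\<close> by blast
  qed
qed

end
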